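(* Let $c\geq 1$ be a real number and let $G$ be a finite graph with growth $f_G(r)\leq cr$ for every positive integer $r$. Then $G$ is isomorphic to a subgraph of $T\boxtimes K_{\lfloor 882c^3\rfloor}$ for some tree $T$.
   Context: The growth of a finite graph $G$ is the function $f_G\colon\mathbb{N}\to\mathbb{N}$ where $f_G(r)$ is the maximum of $|V(H)|$ over all subgraphs $H$ of $G$ of radius at most $r$. $K_t$ is the complete graph on $t$ vertices. The strong product $G\boxtimes H$ has vertex set $V(G)\times V(H)$, with distinct vertices $(v,w)$ and $(v',w')$ adjacent iff ($vv'\in E(G)$ and $w=w'$), or ($v=v'$ and $ww'\in E(H)$), or ($vv'\in E(G)$ and $ww'\in E(H)$). *)

theory Defs
  imports Complex_Main
begin

text \<open>A (simple, undirected) graph: vertex set V and a symmetric irreflexive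
  adjacency relation E supported on V.\<close>
definition graph :: "'a set \<Rightarrow> ('a \<Rightarrow> 'a \<Rightarrow> bool) \<Rightarrow> bool" where
  "graph V E \<longleftrightarrow> (\<forall>x y. E x y \<longrightarrow> x \<in> V \<and> y \<in> V) \<and> (\<forall>x y. E x y \<longrightarrow> E y x) \<and> (\<forall>x. \<not> E x x)"

text \<open>(W,F) is a subgraph of (V,E).\<close>
definition subgraph :: "'a set \<Rightarrow> ('a \<Rightarrow> 'a \<Rightarrow> bool) \<Rightarrow> 'a set \<Rightarrow> ('a \<Rightarrow> 'a \<Rightarrow> bool) \<Rightarrow> bool" where
  "subgraph W F V E \<longleftrightarrow> graph W F \<and> W \<subseteq> V \<and> (\<forall>x y. F x y \<longrightarrow> E x y)"

text \<open>w is at distance at most r from v in the graph with adjacency E.\<close>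
definition dist_le :: "('a \<Rightarrow> 'a \<Rightarrow> bool) \<Rightarrow> 'a \<Rightarrow> 'a \<Rightarrow> nat \<Rightarrow> bool" where
  "dist_le E v w r \<longleftrightarrow> (v, w) \<in> ({(x, y). E x y} \<union> Id) ^^ r"

text \<open>Radius at most r: some centre vertex within distance r of every vertex.\<close>
definition radius_le :: "'a set \<Rightarrow> ('a \<Rightarrow> 'a \<Rightarrow> bool) \<Rightarrow> nat \<Rightarrow> bool" where
  "radius_le V E r \<longleftrightarrow> (\<exists>v\<in>V. \<forall>w\<in>V. dist_le E v w r)"

text \<open>Growth f_G(r): maximum number of vertices of a subgraph of radius at most r.\<close>
definition growth :: "'a set \<Rightarrow> ('a \<Rightarrow> 'a \<Rightarrow> bool) \<Rightarrow> nat \<Rightarrow> nat" where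
  "growth V E r = Sup {card W | W F. subgraph W F V E \<and> radius_le W F r}"

definition connected_graph :: "'a set \<Rightarrow> ('a \<Rightarrow> 'a \<Rightarrow> bool) \<Rightarrow> bool" where
  "connected_graph V E \<longleftrightarrow> V \<noteq> {} \<and> (\<forall>x\<in>V. \<forall>y\<in>V. (x, y) \<in> {(a, b). E a b}\<^sup>*)"

text \<open>A cycle: at least 3 distinct vertices, consecutive ones adjacent, last adjacent to first.\<close>
definition is_cycle :: "('a \<Rightarrow> 'a \<Rightarrow> bool) \<Rightarrow> 'a list \<Rightarrow> bool" where
  "is_cycle E cs \<longleftrightarrow> length cs \<ge> 3 \<and> distinct cs \<and>
     (\<forall>i. Suc i < length cs \<longrightarrow> E (cs ! i) (cs ! Suc i)) \<and> E (last cs) (hd cs)"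

definition tree :: "'a set \<Rightarrow> ('a \<Rightarrow> 'a \<Rightarrow> bool) \<Rightarrow> bool" where
  "tree V E \<longleftrightarrow> graph V E \<and> finite V \<and> connected_graph V E \<and> (\<nexists>cs. is_cycle E cs)"

text \<open>Complete graph K_t on vertices {0..<t}.\<close>
definition complete_verts :: "nat \<Rightarrow> nat set" where
  "complete_verts t = {0..<t}"

definition complete_adj :: "nat \<Rightarrow> nat \<Rightarrow> nat \<Rightarrow> bool" where
  "complete_adj t x y \<longleftrightarrow> x < t \<and> y < t \<and> x \<noteq> y"

text \<open>Strong product of (V1,E1) and (V2,E2).\<close>
definition strong_verts :: "'a set \<Rightarrow> 'b set \<Rightarrow> ('a \<times> 'b) set" where
  "strong_verts V1 V2 = V1 \<times> V2"

definition strong_adj :: "'a set \<Rightarrow> ('a \<Rightarrow> 'a \<Rightarrow> bool) \<Rightarrow> 'b set \<Rightarrow> ('b \<Rightarrow> 'b \<Rightarrow> bool)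
    \<Rightarrow> 'a \<times> 'b \<Rightarrow> 'a \<times> 'b \<Rightarrow> bool" where
  "strong_adj V1 E1 V2 E2 p q \<longleftrightarrow> p \<in> V1 \<times> V2 \<and> q \<in> V1 \<times> V2 \<and> p \<noteq> q \<and>
     ((E1 (fst p) (fst q) \<and> snd p = snd q) \<or> (fst p = fst q \<and> E2 (snd p) (snd q)) \<or>
      (E1 (fst p) (fst q) \<and> E2 (snd p) (snd q)))"

definition graph_iso :: "'a set \<Rightarrow> ('a \<Rightarrow> 'a \<Rightarrow> bool) \<Rightarrow> 'b set \<Rightarrow> ('b \<Rightarrow> 'b \<Rightarrow> bool) \<Rightarrow> ('a \<Rightarrow> 'b) \<Rightarrow> bool" where
  "graph_iso V E W F f \<longleftrightarrow> bij_betw f V W \<and> (\<forall>x\<in>V. \<forall>y\<in>V. E x y \<longleftrightarrow> F (f x) (f y))"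

text \<open>(V,E) is isomorphic to a subgraph of (V',E').\<close>
definition iso_to_subgraph :: "'a set \<Rightarrow> ('a \<Rightarrow> 'a \<Rightarrow> bool) \<Rightarrow> 'b set \<Rightarrow> ('b \<Rightarrow> 'b \<Rightarrow> bool) \<Rightarrow> bool" where
  "iso_to_subgraph V E V' E' \<longleftrightarrow> (\<exists>W F f. subgraph W F V' E' \<and> graph_iso V E W F f)"

end

theory Submission
  imports Defs
begin

text \<open>
  A large set S of vertices can be split by at most 2c vertices into two sides that each contain
  at least 8c vertices of S: for the least radius r such that some ball of radius r contains 8c
  vertices of S, one of the r levels just outside that ball has at most 2c vertices, while the
  concentric ball of radius 2r is covered by at most 6c balls of radius less than r and hence
  contains at most 48 c^2 vertices of S.
  A tree-partition with S in its root bag is then built recursively. If S is small, it is the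
  root bag, and the recursion continues with the neighbours of S, of which there are at most
  c |S| because degrees are less than c. If S is large, it is split as above, and the root bags
  of the two sides are merged. The bound 2|S| - 8c on the root bag survives the merging because
  the separator, which is counted on both sides, has at most 2c vertices. No tree decomposition
  is needed.
\<close>

section \<open>Balls in a graph and their sizes\<close>

definition nball :: "('a \<Rightarrow> 'a \<Rightarrow> bool) \<Rightarrow> 'a \<Rightarrow> nat \<Rightarrow> 'a set" where
  "nball E v r = {w. dist_le E v w r}"

lemma nball_0 [simp]: "nball E v 0 = {v}"
  by (auto simp: nball_def dist_le_def)

lemma nball_Suc: "nball E v (Suc r) = nball E v r \<union> {y. \<exists>x\<in>nball E v r. E x y}"
  by (auto simp: nball_def dist_le_def)

lemma nball_1: "nball E v 1 = insert v {y. E v y}"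
  using nball_Suc[of E v 0] by auto

lemma nball_mono: "r \<le> s \<Longrightarrow> nball E v r \<subseteq> nball E v s"
  by (rule lift_Suc_mono_le[where f = "nball E v"]) (auto simp: nball_Suc)

lemma centre_in_nball: "v \<in> nball E v r"
  using nball_mono[of 0 r E v] by simp

lemma nball_trans: "x \<in> nball E v m \<Longrightarrow> y \<in> nball E x n \<Longrightarrow> y \<in> nball E v (m + n)"
  unfolding nball_def dist_le_def by (auto intro: relpow_trans)

lemma nball_sym:
  assumes "\<And>x y. E x y \<Longrightarrow> E y x" and "x \<in> nball E v n"
  shows "v \<in> nball E x n"
  using assms(2)
proof (induction n arbitrary: x)
  case (Suc n)
  show ?case
  proof (cases "x \<in> nball E v n")
    case True
    then show ?thesis using Suc.IH by (auto simp: nball_Suc)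
  next
    case False
    then obtain y where y: "y \<in> nball E v n" "E y x" using Suc.prems by (auto simp: nball_Suc)
    then have "y \<in> nball E x 1" using assms(1) nball_1[of E x] by auto
    from nball_trans[OF this Suc.IH[OF y(1)]] show ?thesis by simp
  qed
qed simp

lemma nball_subset:
  assumes "graph U E" and "v \<in> U"
  shows "nball E v r \<subseteq> U"
  by (induction r) (use assms in \<open>auto simp: nball_Suc graph_def\<close>)

lemma nball_mono_edges:
  assumes "\<And>x y. E x y \<Longrightarrow> F x y"
  shows "nball E v r \<subseteq> nball F v r"
  by (induction r) (use assms in \<open>auto simp: nball_Suc\<close>)

text \<open>A ball that gains nothing in one step is closed under adjacency, so no later step can
  leave it.\<close>

lemma nball_stable:
  assumes "nball E v (Suc r) = nball E v r"
  shows "nball E v n \<subseteq> nball E v r"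
proof (induction n)
  case 0
  then show ?case by (simp add: centre_in_nball)
next
  case (Suc n)
  then have "nball E v (Suc n) \<subseteq> nball E v (Suc r)" by (auto simp: nball_Suc)
  then show ?case using assms by simp
qed

text \<open>Until the balls fill the component of \<open>v\<close>, each step adds at least one
  vertex, by \<open>nball_stable\<close>.\<close>

lemma card_nball_ge:
  assumes "\<And>n. finite (nball E v n)" and "\<not> nball E v n \<subseteq> nball E v r"
  shows "card (nball E v r) \<ge> Suc r"
  using assms(2)
proof (induction r)
  case (Suc r)
  have "nball E v r \<subseteq> nball E v (Suc r)" by (rule nball_mono) simp
  moreover from this have "\<not> nball E v n \<subseteq> nball E v r" using Suc.prems by blast
  moreover from this have "nball E v (Suc r) \<noteq> nball E v r" using nball_stable by metis
  ultimately have "card (nball E v r) < card (nball E v (Suc r))"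
    by (intro psubset_card_mono assms(1)) auto
  moreover have "Suc r \<le> card (nball E v r)" by (rule Suc.IH) fact
  ultimately show ?case by linarith
qed simp

text \<open>The ball induces a subgraph of radius at most \<open>r\<close>. All sizes in the
  supremum are bounded by \<open>card V\<close>, so the supremum is an upper bound.\<close>

lemma card_nball_le_growth:
  assumes G: "graph V E" and "finite V" and v: "v \<in> V"
  shows "card (nball E v r) \<le> growth V E r"
proof -
  define W where "W = nball E v r"
  define F where "F = (\<lambda>x y. x \<in> W \<and> y \<in> W \<and> E x y)"
  have W: "W \<subseteq> V" unfolding W_def by (rule nball_subset[OF G v])
  have sub: "subgraph W F V E"
    using G W by (auto simp: subgraph_def graph_def F_def)
  \<comment> \<open>The steps that build the balls up to radius \<open>r\<close> stay inside
    \<open>W\<close>, so \<open>F\<close> reaches as far as \<open>E\<close>.\<close>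
  have "nball E v n \<subseteq> nball F v n" if "n \<le> r" for n
    using that
  proof (induction n)
    case (Suc n)
    have "nball E v (Suc n) \<subseteq> W" "nball E v n \<subseteq> W"
      unfolding W_def using Suc.prems by (auto intro!: nball_mono)
    then show ?case using Suc by (fastforce simp: nball_Suc F_def)
  qed simp
  then have "W \<subseteq> nball F v r" by (simp add: W_def)
  moreover have "v \<in> W" by (simp add: W_def centre_in_nball)
  ultimately have "radius_le W F r" by (auto simp: radius_le_def nball_def)
  with sub have "card W \<in> {card W | W F. subgraph W F V E \<and> radius_le W F r}" by blast
  moreover have "bdd_above {card W | W F. subgraph W F V E \<and> radius_le W F r}"
    by (rule bdd_aboveI[of _ "card V"]) (use assms(2) in \<open>auto simp: subgraph_def intro: card_mono\<close>)
  ultimately show ?thesis unfolding growth_def W_def[symmetric] by (rule cSup_upper)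
qed

section \<open>Balanced separators from linear growth\<close>

text \<open>If all \<open>r\<close> increments between \<open>r\<close> and \<open>r + r\<close>
  exceeded \<open>d\<close>, they would sum to more than \<open>d * r\<close>, as \<open>a r\<close>
  is nonnegative.\<close>

lemma thin_level:
  fixes a :: "nat \<Rightarrow> nat" and d :: real
  assumes "r > 0" and "real (a (r + r)) \<le> d * real r"
  obtains j where "r \<le> j" "j < r + r" "real (a (Suc j)) - real (a j) \<le> d"
proof -
  have "\<exists>j. r \<le> j \<and> j < r + r \<and> real (a (Suc j)) - real (a j) \<le> d"
  proof (rule ccontr)
    assume *: "\<not> ?thesis"
    have step: "real (a (r + Suc i)) > real (a (r + i)) + d" if "i < r" for i
    proof -
      have "\<not> real (a (Suc (r + i))) - real (a (r + i)) \<le> d"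
        using *[simplified, rule_format, of "r + i"] that by simp
      then show ?thesis by simp
    qed
    have "i < r \<Longrightarrow> real (a (r + Suc i)) > d * real (Suc i)" for i
    proof (induction i)
      case 0
      then show ?case using step[of 0] by simp
    next
      case (Suc i)
      then have "real (a (r + Suc i)) > d * real (Suc i)" by simp
      moreover have "d * real (Suc (Suc i)) = d * real (Suc i) + d" by (simp add: algebra_simps)
      ultimately show ?case using step[OF Suc.prems] by linarith
    qed
    from this[of "r - 1"] have "real (a (r + r)) > d * real r" using assms(1) by simp
    then show False using assms(2) by linarith
  qed
  then show ?thesis using that by blast
qed

text \<open>Take an inclusion-maximal set of pairwise unrelated points. \<open>R\<close> may be
  asymmetric, hence the two directions in the last conclusion.\<close>

lemma max_packing:
  assumes "finite Y"
  obtains P where "P \<subseteq> Y" "\<And>p q. p \<in> P \<Longrightarrow> q \<in> P \<Longrightarrow> p \<noteq> q \<Longrightarrow> \<not> R p q"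
    "\<And>y. y \<in> Y \<Longrightarrow> y \<in> P \<or> (\<exists>p\<in>P. R p y \<or> R y p)"
proof -
  define Z where "Z = {P. P \<subseteq> Y \<and> (\<forall>p\<in>P. \<forall>q\<in>P. p \<noteq> q \<longrightarrow> \<not> R p q)}"
  have "finite Z" unfolding Z_def using assms by (simp add: finite_subset[of _ "Pow Y"])
  moreover have "{} \<in> Z" by (auto simp: Z_def)
  ultimately obtain P where P: "P \<in> Z" "\<And>Q. Q \<in> Z \<Longrightarrow> P \<subseteq> Q \<Longrightarrow> P = Q"
    using finite_has_maximal[of Z] by blast
  have "y \<in> P \<or> (\<exists>p\<in>P. R p y \<or> R y p)" if "y \<in> Y" for y
  proof (rule ccontr)
    assume *: "\<not> ?thesis"
    then have "insert y P \<in> Z" using P(1) that by (auto simp: Z_def)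
    with P(2)[of "insert y P"] * show False by blast
  qed
  with P(1) show ?thesis using that[of P] by (auto simp: Z_def)
qed

lemma card_UN_le_mult:
  fixes d :: real
  assumes "finite P" and "\<And>p. p \<in> P \<Longrightarrow> real (card (A p)) \<le> d"
  shows "real (card (\<Union>p\<in>P. A p)) \<le> real (card P) * d"
proof -
  have "real (card (\<Union>p\<in>P. A p)) \<le> real (\<Sum>p\<in>P. card (A p))"
    using card_UN_le[OF assms(1)] of_nat_le_iff by blast
  also have "\<dots> \<le> (\<Sum>p\<in>P. d)" unfolding of_nat_sum by (rule sum_mono) (use assms in auto)
  finally show ?thesis by simp
qed

text \<open>Balls of radius \<open>r - 1\<close> around a maximal packing cover the part of
  \<open>S\<close> in question, and each holds fewer than M vertices of \<open>S\<close>. The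
  packing has at most 6c points: they own disjoint sets of at least r/2 vertices inside a ball of at
  most 3cr vertices.\<close>

lemma covering_bound:
  fixes c M :: real
  assumes G: "graph U E" "finite U" and v: "v \<in> U"
    and growth: "\<And>w r. w \<in> U \<Longrightarrow> r > 0 \<Longrightarrow> real (card (nball E w r)) \<le> c * real r"
    and r: "r > 0" and big: "M \<le> real (card (S \<inter> nball E v r))"
    and small: "\<And>w. w \<in> U \<Longrightarrow> real (card (S \<inter> nball E w (r - 1))) < M"
    and S: "S \<subseteq> U"
  shows "real (card (S \<inter> nball E v (2 * r))) \<le> 6 * c * M"
proof -
  have sym: "E x y \<Longrightarrow> E y x" for x y using G by (auto simp: graph_def)
  have fin: "finite (nball E w n)" if "w \<in> U" for w n
    using nball_subset[OF G(1) that] G(2) finite_subset by blast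
  text \<open>Balls of radius k around the points of a maximal packing P are disjoint and have at
    least r/2 vertices each, as a smaller one would be a whole component.\<close>
  define k where "k = (r - 1) div 2"
  obtain P where P: "P \<subseteq> S \<inter> nball E v (2 * r)"
    "\<And>p q. p \<in> P \<Longrightarrow> q \<in> P \<Longrightarrow> p \<noteq> q \<Longrightarrow> q \<notin> nball E p (r - 1)"
    "\<And>y. y \<in> S \<inter> nball E v (2 * r) \<Longrightarrow> y \<in> P \<or> (\<exists>p\<in>P. y \<in> nball E p (r - 1) \<or> p \<in> nball E y (r - 1))"
    using max_packing[of "S \<inter> nball E v (2 * r)" "\<lambda>p q. q \<in> nball E p (r - 1)"] fin[OF v]
    by (metis finite_Int)
  have PU: "P \<subseteq> U" using P(1) S by blast
  have finP: "finite P" using PU G(2) finite_subset by blast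
  have large: "real r / 2 \<le> real (card (nball E p k))" if p: "p \<in> P" for p
  proof -
    have pU: "p \<in> U" using p PU by blast
    \<comment> \<open>Since \<open>p\<close> is within 2r of \<open>v\<close>, the ball of radius 3r
      around \<open>p\<close> contains \<open>nball E v r\<close> and so M vertices of
      \<open>S\<close>, too many for a ball of radius \<open>r - 1\<close>.\<close>
    have "\<not> nball E p (2 * r + r) \<subseteq> nball E p k"
    proof
      assume *: "nball E p (2 * r + r) \<subseteq> nball E p k"
      have "v \<in> nball E p (2 * r)" using nball_sym[of E p v] sym p P(1) by blast
      then have "nball E v r \<subseteq> nball E p (2 * r + r)" using nball_trans by fast
      also note *
      also have "nball E p k \<subseteq> nball E p (r - 1)" by (rule nball_mono) (simp add: k_def)
      finally have "card (S \<inter> nball E v r) \<le> card (S \<inter> nball E p (r - 1))"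
        by (intro card_mono) (use fin[OF pU] in auto)
      with big small[OF pU] show False by linarith
    qed
    then have "Suc k \<le> card (nball E p k)" by (rule card_nball_ge[OF fin[OF pU]])
    then show ?thesis using r unfolding k_def by linarith
  qed
  have disj: "nball E p k \<inter> nball E q k = {}" if "p \<in> P" "q \<in> P" "p \<noteq> q" for p q
  proof (rule ccontr)
    assume "\<not> ?thesis"
    then obtain x where "x \<in> nball E p k" "x \<in> nball E q k" by blast
    then have "q \<in> nball E p (k + k)" using nball_trans nball_sym[of E x q] sym by metis
    moreover have "k + k \<le> r - 1" by (simp add: k_def)
    ultimately show False using P(2)[OF that] nball_mono[of "k + k" "r - 1" E p] by blast
  qed
  have "real (card P) * (real r / 2) \<le> (\<Sum>p\<in>P. real (card (nball E p k)))"
    using sum_mono[of P "\<lambda>p. real r / 2" "\<lambda>p. real (card (nball E p k))"] large by simp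
  also have "\<dots> = real (card (\<Union>p\<in>P. nball E p k))"
    by (subst card_UN_disjoint) (use finP PU fin disj in auto)
  also have "\<dots> \<le> real (card (nball E v (3 * r)))"
  proof -
    have "nball E p k \<subseteq> nball E v (3 * r)" if "p \<in> P" for p
    proof -
      have "nball E p k \<subseteq> nball E v (2 * r + k)" using that P(1) nball_trans by fast
      also have "\<dots> \<subseteq> nball E v (3 * r)" by (rule nball_mono) (simp add: k_def)
      finally show ?thesis .
    qed
    then show ?thesis by (intro of_nat_mono card_mono) (use fin[OF v] in auto)
  qed
  also have "\<dots> \<le> c * (3 * real r)" using growth[OF v, of "3 * r"] r by simp
  finally have cP: "real (card P) \<le> 6 * c" using r by (simp add: field_simps)
  have M: "0 \<le> M" using small[OF v] by linarith
  have "S \<inter> nball E v (2 * r) \<subseteq> (\<Union>p\<in>P. S \<inter> nball E p (r - 1))"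
  proof
    fix y assume y: "y \<in> S \<inter> nball E v (2 * r)"
    from P(3)[OF y] obtain p where "p \<in> P" "y = p \<or> y \<in> nball E p (r - 1) \<or> p \<in> nball E y (r - 1)"
      by blast
    moreover from this have "y \<in> nball E p (r - 1)"
      using nball_sym[of E p y] sym centre_in_nball[of p E] by blast
    ultimately show "y \<in> (\<Union>p\<in>P. S \<inter> nball E p (r - 1))" using y by blast
  qed
  then have "card (S \<inter> nball E v (2 * r)) \<le> card (\<Union>p\<in>P. S \<inter> nball E p (r - 1))"
    by (intro card_mono finite_subset[OF _ G(2)]) (use S in blast)
  moreover have "real (card (\<Union>p\<in>P. S \<inter> nball E p (r - 1))) \<le> real (card P) * M"
    by (rule card_UN_le_mult[OF finP]) (use small PU less_imp_le in blast)
  moreover have "\<dots> \<le> 6 * c * M" using cP M by (rule mult_right_mono)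
  ultimately show ?thesis by linarith
qed

text \<open>The threshold 56c^2 leaves enough for \<open>Q\<close> in both cases. If some ball is
  rich in \<open>S\<close>, then \<open>P\<close> and \<open>X\<close> together take at most 48c^2
  vertices of \<open>S\<close>, leaving 8c^2 >= 8c. Otherwise \<open>X\<close> is empty and
  \<open>P\<close> takes fewer than 16c.\<close>

lemma separation:
  fixes c :: real
  assumes c: "c \<ge> 1" and G: "graph U E" "finite U"
    and growth: "\<And>w r. w \<in> U \<Longrightarrow> r > 0 \<Longrightarrow> real (card (nball E w r)) \<le> c * real r"
    and S: "S \<subseteq> U" and cS: "real (card S) \<ge> 56 * c\<^sup>2"
  obtains P X Q where "U = P \<union> X \<union> Q" "P \<inter> X = {}" "P \<inter> Q = {}" "X \<inter> Q = {}"
    "\<And>x y. x \<in> P \<Longrightarrow> y \<in> Q \<Longrightarrow> \<not> E x y" "real (card X) \<le> 2 * c"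
    "real (card (S \<inter> P)) \<ge> 8 * c" "real (card (S \<inter> Q)) \<ge> 8 * c"
proof -
  have sym: "E x y \<Longrightarrow> E y x" for x y using G by (auto simp: graph_def)
  have fin: "finite (nball E w n)" if "w \<in> U" for w n
    using nball_subset[OF G(1) that] G(2) finite_subset by blast
  have finS: "finite S" using S G(2) finite_subset by blast
  have c2: "c \<le> c\<^sup>2" using c by (simp add: power2_eq_square)
  have card_diff: "real (card (S \<inter> (U - A))) = real (card S) - real (card (S \<inter> A))" for A
  proof -
    have "S \<inter> (U - A) = S - (S \<inter> A)" using S by blast
    then show ?thesis using finS by (simp add: card_Diff_subset of_nat_diff card_mono)
  qed
  let ?big = "\<lambda>r. \<exists>v\<in>U. real (card (S \<inter> nball E v r)) \<ge> 8 * c"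
  show ?thesis
  proof (cases "\<exists>r. ?big r")
    case True
    define r where "r = (LEAST r. ?big r)"
    have "?big r" unfolding r_def using True by (rule LeastI_ex)
    then obtain v where v: "v \<in> U" "real (card (S \<inter> nball E v r)) \<ge> 8 * c" by blast
    \<comment> \<open>A ball of radius 0 is a single vertex, fewer than 8c. Hence
      \<open>r - 1\<close> is a genuine predecessor and minimality of \<open>r\<close> applies to
      it.\<close>
    have r: "r > 0"
    proof (rule ccontr)
      assume "\<not> r > 0"
      then have "card (S \<inter> nball E v r) \<le> card {v}" by (intro card_mono) auto
      with v(2) c show False by simp
    qed
    then have "\<not> ?big (r - 1)" unfolding r_def by (intro not_less_Least) simp
    then have small: "real (card (S \<inter> nball E w (r - 1))) < 8 * c" if "w \<in> U" for w
      using that by force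
    \<comment> \<open>The ball of radius 2r has at most 2cr vertices, so one of the \<open>r\<close>
      levels beyond radius \<open>r\<close> has at most 2c.\<close>
    have "real (card (nball E v (r + r))) \<le> (2 * c) * real r"
      using growth[OF v(1), of "r + r"] r by simp
    then obtain j where j: "r \<le> j" "j < r + r"
      "real (card (nball E v (Suc j))) - real (card (nball E v j)) \<le> 2 * c"
      using thin_level[OF r, of "\<lambda>j. card (nball E v j)"] by blast
    let ?B = "nball E v"
    have sub: "?B j \<subseteq> ?B (Suc j)" "?B (Suc j) \<subseteq> U"
      using nball_mono[of j "Suc j" E v] nball_subset[OF G(1) v(1), of "Suc j"] by auto
    have "card (S \<inter> ?B (Suc j)) \<le> card (S \<inter> ?B (2 * r))"
      using nball_mono[of "Suc j" "2 * r" E v] j by (intro card_mono) (use finS in auto)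
    also have "real (card (S \<inter> ?B (2 * r))) \<le> 6 * c * (8 * c)"
      by (rule covering_bound[OF G v(1) growth r v(2) small S])
    finally have le: "real (card (S \<inter> ?B (Suc j))) \<le> 48 * c\<^sup>2"
      by (simp add: power2_eq_square)
    show ?thesis
    proof (rule that[of "?B j" "?B (Suc j) - ?B j" "U - ?B (Suc j)"])
      show "\<not> E x y" if "x \<in> ?B j" "y \<in> U - ?B (Suc j)" for x y
        using that by (auto simp: nball_Suc)
      show "real (card (?B (Suc j) - ?B j)) \<le> 2 * c"
        using j(3) sub(1) fin[OF v(1)] by (simp add: card_Diff_subset of_nat_diff card_mono)
      have "card (S \<inter> ?B r) \<le> card (S \<inter> ?B j)"
        using nball_mono[OF j(1), of E v] by (intro card_mono) (use finS in auto)
      then show "8 * c \<le> real (card (S \<inter> ?B j))" using v(2) by linarith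
      show "8 * c \<le> real (card (S \<inter> (U - ?B (Suc j))))"
        unfolding card_diff using le cS c2 by linarith
    qed (use sub in auto)
  next
    case False
    text \<open>All components contain few vertices of S, so a minimal union A of components with at
      least 8c vertices of S contains fewer than 16c of them.\<close>
    define Z where "Z = {A. A \<subseteq> U \<and> (\<forall>x\<in>A. \<forall>y. E x y \<longrightarrow> y \<in> A) \<and> 8 * c \<le> real (card (S \<inter> A))}"
    have "U \<in> Z" using G(1) S cS c2 c by (auto simp: Z_def graph_def Int_absorb2)
    moreover have "finite Z" unfolding Z_def using G(2) by (simp add: finite_subset[of _ "Pow U"])
    ultimately obtain A where A: "A \<in> Z" "\<And>B. B \<in> Z \<Longrightarrow> B \<subseteq> A \<Longrightarrow> A = B"
      using finite_has_minimal[of Z] by blast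
    have AU: "A \<subseteq> U" and Acl: "\<And>x y. x \<in> A \<Longrightarrow> E x y \<Longrightarrow> y \<in> A"
      and cA: "8 * c \<le> real (card (S \<inter> A))" using A(1) by (auto simp: Z_def)
    have "A \<noteq> {}" using cA c by auto
    then obtain v where v: "v \<in> A" by blast
    have vU: "v \<in> U" using v AU by blast
    \<comment> \<open>This is the component of \<open>v\<close>: a ball of radius
      \<open>card U\<close> that could still grow would have more than \<open>card U\<close>
      vertices.\<close>
    define C where "C = nball E v (card U)"
    have "nball E v n \<subseteq> C" for n
    proof (rule ccontr)
      assume "\<not> nball E v n \<subseteq> C"
      then have "Suc (card U) \<le> card C"
        unfolding C_def by (rule card_nball_ge[OF fin[OF vU]])
      moreover have "card C \<le> card U"
        unfolding C_def by (rule card_mono[OF G(2) nball_subset[OF G(1) vU]])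
      ultimately show False by linarith
    qed
    from this[of "Suc (card U)"] have Ccl: "y \<in> C" if "x \<in> C" "E x y" for x y
      using that unfolding C_def nball_Suc by blast
    have vC: "v \<in> C" by (simp add: C_def centre_in_nball)
    \<comment> \<open>\<open>A - C\<close> is still a union of components, so minimality of
      \<open>A\<close> can only mean that it has fewer than 8c vertices of \<open>S\<close>.\<close>
    have "A - C \<notin> Z" using A(2)[of "A - C"] v vC by blast
    moreover have "A - C \<subseteq> U" "\<forall>x\<in>A - C. \<forall>y. E x y \<longrightarrow> y \<in> A - C" using AU Acl Ccl sym by blast+
    ultimately have "real (card (S \<inter> (A - C))) < 8 * c" unfolding Z_def by force
    moreover have "real (card (S \<inter> C)) < 8 * c" using False vU unfolding C_def by (meson not_le)
    moreover have "card (S \<inter> A) \<le> card (S \<inter> (A - C)) + card (S \<inter> C)"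
    proof -
      have "card (S \<inter> A) \<le> card ((S \<inter> (A - C)) \<union> (S \<inter> C))"
        by (intro card_mono) (use finS in auto)
      also have "\<dots> \<le> card (S \<inter> (A - C)) + card (S \<inter> C)" by (rule card_Un_le)
      finally show ?thesis .
    qed
    ultimately have "real (card (S \<inter> A)) < 16 * c" by linarith
    then have "8 * c \<le> real (card (S \<inter> (U - A)))"
      unfolding card_diff using cS c2 c by linarith
    then show ?thesis
      by (intro that[of A "{}" "U - A"]) (use AU Acl cA c in auto)
  qed
qed

section \<open>Tree-partitions and two ways to build them\<close>

text \<open>
  The tree is encoded by a parent function p with root 0. Truncated subtraction makes
  p i \<le> i - 1 say that p 0 = 0 and that p i < i for all other i.
\<close>
definition tree_partition :: "'a set \<Rightarrow> ('a \<Rightarrow> 'a \<Rightarrow> bool) \<Rightarrow> ('a \<Rightarrow> nat) \<Rightarrow> (nat \<Rightarrow> nat) \<Rightarrow> bool" where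
  "tree_partition U E f p \<longleftrightarrow> (\<forall>i. p i \<le> i - 1) \<and>
     (\<forall>x\<in>U. \<forall>y\<in>U. E x y \<longrightarrow> f x = f y \<or> p (f x) = f y \<or> p (f y) = f x)"

definition bag :: "'a set \<Rightarrow> ('a \<Rightarrow> nat) \<Rightarrow> nat \<Rightarrow> 'a set" where
  "bag U f i = {x \<in> U. f x = i}"

text \<open>All old nodes move up by one to make room for the root bag \<open>S\<close>. The old
  root becomes node 1, a child of 0, and its bag contains all outside neighbours of
  \<open>S\<close>.\<close>

lemma tree_partition_new_root:
  assumes T: "tree_partition (U - S) E f p"
    and N: "\<And>x y. x \<in> S \<Longrightarrow> y \<in> U - S \<Longrightarrow> E x y \<or> E y x \<Longrightarrow> f y = 0"
  shows "tree_partition U E (\<lambda>x. if x \<in> S then 0 else Suc (f x))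
    (\<lambda>i. if i \<le> 1 then 0 else Suc (p (i - 1)))" (is "tree_partition U E ?g ?q")
proof -
  have p: "p i \<le> i - 1" for i using T by (auto simp: tree_partition_def)
  have "Suc (p (i - 1)) \<le> i - 1" if "i > 1" for i using p[of "i - 1"] that by linarith
  then have "(if i \<le> 1 then 0 else Suc (p (i - 1))) \<le> i - 1" for i by simp
  moreover have "?g x = ?g y \<or> ?q (?g x) = ?g y \<or> ?q (?g y) = ?g x"
    if xy: "x \<in> U" "y \<in> U" "E x y" for x y
  proof -
    \<comment> \<open>The old root was its own parent but now has parent 0. An edge that relied on
      the old value has both ends in the old root bag.\<close>
    have p0: "p 0 = 0" using p[of 0] by simp
    consider "x \<in> S" "y \<in> S" | "x \<in> S" "y \<in> U - S" | "x \<in> U - S" "y \<in> S"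
      | "x \<in> U - S" "y \<in> U - S" using xy by blast
    then show ?thesis
    proof cases
      case 4
      then have "f x = f y \<or> p (f x) = f y \<or> p (f y) = f x"
        using T xy(3) by (auto simp: tree_partition_def)
      then show ?thesis using 4 p0 by (auto simp: not_le)
    qed (use xy N in auto)
  qed
  ultimately show ?thesis unfolding tree_partition_def by blast
qed

text \<open>
  The non-root nodes i of the two trees are renumbered 2i and 2i - 1. Truncated subtraction
  sends both roots to 0.
\<close>
lemma tree_partition_merge:
  assumes T1: "tree_partition A E f1 p1" and T2: "tree_partition B E f2 p2"
    and sep: "\<And>x y. x \<in> A - B \<Longrightarrow> y \<in> B - A \<Longrightarrow> \<not> E x y \<and> \<not> E y x"
    and root: "\<And>x. x \<in> A \<inter> B \<Longrightarrow> f1 x = 0 \<and> f2 x = 0"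
  defines "f \<equiv> \<lambda>x. if x \<in> A then 2 * f1 x else 2 * f2 x - 1"
  defines "p \<equiv> \<lambda>i. if even i then 2 * p1 (i div 2) else 2 * p2 (Suc i div 2) - 1"
  shows "tree_partition (A \<union> B) E f p"
proof -
  have p1: "p1 i \<le> i - 1" and p2: "p2 i \<le> i - 1" for i
    using T1 T2 by (auto simp: tree_partition_def)
  have fB: "f x = 2 * f2 x - 1" if "x \<in> B" for x using that root by (auto simp: f_def)
  have p_even: "p (2 * i) = 2 * p1 i" for i by (simp add: p_def)
  \<comment> \<open>For i = 0 the argument is the even number 0, and both sides are 0 because both
    roots are their own parents.\<close>
  have p_odd: "p (2 * i - 1) = 2 * p2 i - 1" for i
    using p1[of 0] p2[of 0] by (cases i) (auto simp: p_def)
  have "p i \<le> i - 1" for i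
    using p1[of "i div 2"] p2[of "Suc i div 2"] by (auto simp: p_def elim!: evenE oddE)
  moreover have "f x = f y \<or> p (f x) = f y \<or> p (f y) = f x"
    if "x \<in> A \<union> B" "y \<in> A \<union> B" "E x y" for x y
  proof -
    have "x \<in> A \<and> y \<in> A \<or> x \<in> B \<and> y \<in> B" using sep that by blast
    then show ?thesis
    proof
      assume "x \<in> A \<and> y \<in> A"
      then show ?thesis using T1 that(3) by (auto simp: tree_partition_def f_def p_even)
    next
      assume xy: "x \<in> B \<and> y \<in> B"
      then have "f2 x = f2 y \<or> p2 (f2 x) = f2 y \<or> p2 (f2 y) = f2 x"
        using T2 that(3) by (auto simp: tree_partition_def)
      then show ?thesis using xy by (metis fB p_odd)
    qed
  qed
  ultimately show ?thesis by (auto simp: tree_partition_def)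
qed

section \<open>Recursive construction of the tree-partition\<close>

text \<open>The bound 56c^3 on \<open>S\<close> is what fewer than 56c^2 vertices with at most c
  neighbours each can produce; 112c^3 is twice that, from the root bound 2|S| - 8c. \<open>V\<close>
  stays fixed through the induction, so the growth bound need not be re-proved for each
  \<open>U\<close>.\<close>

lemma tree_partition_exists:
  fixes c :: real
  assumes c: "c \<ge> 1" and G: "graph V E" "finite V"
    and growth: "\<And>w r. w \<in> V \<Longrightarrow> r > 0 \<Longrightarrow> real (card (nball E w r)) \<le> c * real r"
    and "U \<subseteq> V" "S \<subseteq> U" "real (card S) \<le> 56 * c ^ 3"
  shows "\<exists>f p. tree_partition U E f p \<and> S \<subseteq> bag U f 0 \<and>
    (\<forall>i. real (card (bag U f i)) \<le> 112 * c ^ 3) \<and>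
    (8 * c \<le> real (card S) \<longrightarrow> real (card (bag U f 0)) \<le> 2 * real (card S) - 8 * c)"
  using assms(5-7)
  \<comment> \<open>The second summand makes the measure decrease when S is empty.\<close>
proof (induction "card U + card (U - S)" arbitrary: U S rule: less_induct)
  case less
  have sym: "E x y \<Longrightarrow> E y x" for x y using G by (auto simp: graph_def)
  have finU: "finite U" using less.prems G(2) finite_subset by blast
  have finS: "finite S" using less.prems finU finite_subset by blast
  have c3: "0 \<le> c ^ 3" using c by simp
  show ?case
  proof (cases "real (card S) < 56 * c\<^sup>2")
    case small: True
    have root: "real (card S) \<le> 2 * real (card S) - 8 * c" if "8 * c \<le> real (card S)"
      using that by linarith
    have cS: "real (card S) \<le> 112 * c ^ 3" using less.prems(3) c3 by linarith
    show ?thesis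
    proof (cases "U = S")
      case True
      have "card (bag U (\<lambda>_. 0) i) \<le> card S" for i
        by (rule card_mono[OF finS]) (auto simp: bag_def True)
      then have "real (card (bag U (\<lambda>_. 0) i)) \<le> 112 * c ^ 3" for i
        using cS by (meson le_trans of_nat_mono order_trans)
      moreover have "tree_partition U E (\<lambda>_. 0) (\<lambda>_. 0)" by (simp add: tree_partition_def)
      moreover have "bag U (\<lambda>_. 0) 0 = S" by (auto simp: bag_def True)
      ultimately show ?thesis using root by (metis subset_refl)
    next
      case False
      then obtain v where v: "v \<in> U - S" using less.prems by blast
      define N where "N = {y \<in> U - S. \<exists>x\<in>S. E x y}"
      \<comment> \<open>If \<open>S\<close> has no outside neighbours, any vertex outside
        \<open>S\<close> starts the next root bag, so the recursive call always has a nonempty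
        prescribed set and the measure drops.\<close>
      define N' where "N' = (if N = {} then {v} else N)"
      have N': "N' \<subseteq> U - S" "N' \<noteq> {}" "N \<subseteq> N'" using v by (auto simp: N'_def N_def)
      have "N \<subseteq> (\<Union>x\<in>S. nball E x 1)" unfolding N_def nball_1 by blast
      moreover have "finite (nball E x 1)" if "x \<in> S" for x
        using nball_subset[OF G(1)] G(2) that less.prems finite_subset by (metis subsetD)
      ultimately have "card N \<le> card (\<Union>x\<in>S. nball E x 1)"
        by (intro card_mono) (use finS in auto)
      also have "real \<dots> \<le> real (card S) * c"
        by (rule card_UN_le_mult[OF finS]) (use growth[of _ 1] less.prems in auto)
      also have "\<dots> \<le> 56 * c\<^sup>2 * c" by (rule mult_right_mono) (use small c in auto)
      also have "\<dots> = 56 * c ^ 3" by (simp add: power2_eq_square power3_eq_cube)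
      finally have "real (card N) \<le> 56 * c ^ 3" by simp
      moreover have "1 \<le> c ^ 3" using c by simp
      ultimately have cN': "real (card N') \<le> 56 * c ^ 3" by (auto simp: N'_def)
      have "card (U - S - N') < card (U - S)"
        by (rule psubset_card_mono) (use finU N' in auto)
      moreover have "card (U - S) \<le> card U" by (rule card_mono) (use finU in auto)
      ultimately have "card (U - S) + card (U - S - N') < card U + card (U - S)" by linarith
      from less.hyps[OF this _ N'(1) cN'] less.prems(1)
      obtain f p where fp: "tree_partition (U - S) E f p" "N' \<subseteq> bag (U - S) f 0"
        "\<And>i. real (card (bag (U - S) f i)) \<le> 112 * c ^ 3" by blast
      define g where "g = (\<lambda>x. if x \<in> S then 0 else Suc (f x))"
      have "f y = 0" if "x \<in> S" "y \<in> U - S" "E x y \<or> E y x" for x y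
      proof -
        have "y \<in> N" using that sym by (auto simp: N_def)
        then show ?thesis using fp(2) N'(3) by (auto simp: bag_def)
      qed
      then obtain q where T: "tree_partition U E g q"
        using tree_partition_new_root[OF fp(1)] unfolding g_def by blast
      have bag0: "bag U g 0 = S" using less.prems by (auto simp: bag_def g_def)
      have "real (card (bag U g i)) \<le> 112 * c ^ 3" for i
      proof (cases i)
        case 0
        then show ?thesis using bag0 cS by simp
      next
        case (Suc k)
        have "bag U g (Suc k) = bag (U - S) f k" by (auto simp: bag_def g_def split: if_splits)
        then show ?thesis using fp(3) Suc by simp
      qed
      with T bag0 root show ?thesis by blast
    qed
  next
    case False
    \<comment> \<open>\<open>separation\<close> needs a graph supported on \<open>U\<close>.
      Deleting edges only shrinks balls, so the growth bound survives.\<close>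
    define F where "F = (\<lambda>x y. x \<in> U \<and> y \<in> U \<and> E x y)"
    have GF: "graph U F" using G(1) by (auto simp: graph_def F_def)
    have growthF: "real (card (nball F w r)) \<le> c * real r" if "w \<in> U" "r > 0" for w r
    proof -
      have wV: "w \<in> V" using that less.prems by blast
      have "card (nball F w r) \<le> card (nball E w r)"
        by (intro card_mono finite_subset[OF nball_subset[OF G(1) wV] G(2)] nball_mono_edges)
          (simp add: F_def)
      with growth[OF wV that(2)] show ?thesis by linarith
    qed
    from False have large: "56 * c\<^sup>2 \<le> real (card S)" by simp
    obtain P X Q where U: "U = P \<union> X \<union> Q" and dis: "P \<inter> X = {}" "P \<inter> Q = {}" "X \<inter> Q = {}"
      and PQ: "\<And>x y. x \<in> P \<Longrightarrow> y \<in> Q \<Longrightarrow> \<not> F x y" and cX: "real (card X) \<le> 2 * c"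
      and cP: "real (card (S \<inter> P)) \<ge> 8 * c" and cQ: "real (card (S \<inter> Q)) \<ge> 8 * c"
      by (rule separation[OF c GF finU growthF less.prems(2) large]) auto
    have fin: "finite P" "finite X" "finite Q" using U finU by auto
    have S: "card S = card (S \<inter> P) + card (S \<inter> X) + card (S \<inter> Q)"
    proof -
      have "S = (S \<inter> P \<union> S \<inter> X) \<union> S \<inter> Q" using U less.prems(2) by blast
      also have "card \<dots> = card (S \<inter> P \<union> S \<inter> X) + card (S \<inter> Q)"
        by (rule card_Un_disjoint) (use fin dis in auto)
      also have "card (S \<inter> P \<union> S \<inter> X) = card (S \<inter> P) + card (S \<inter> X)"
        by (rule card_Un_disjoint) (use fin dis in auto)
      finally show ?thesis .
    qed
    have ne: "S \<inter> P \<noteq> {}" "S \<inter> Q \<noteq> {}" using cP cQ c by auto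
    \<comment> \<open>Both sides are handled alike, with the separator added to the prescribed set.
      That set stays within 56c^3: the side loses at least 8c vertices of \<open>S\<close> and gains
      at most 2c from \<open>X\<close>.\<close>
    have half: "\<exists>f p. tree_partition (W \<union> X) E f p \<and> S \<inter> W \<union> X \<subseteq> bag (W \<union> X) f 0 \<and>
      (\<forall>i. real (card (bag (W \<union> X) f i)) \<le> 112 * c ^ 3) \<and>
      real (card (bag (W \<union> X) f 0)) \<le> 2 * (real (card (S \<inter> W)) + real (card X)) - 8 * c"
      if W: "W \<union> X \<subset> U" "W \<inter> X = {}" "8 * c \<le> real (card (S \<inter> W))"
        "real (card (S \<inter> W)) + 8 * c \<le> real (card S)" for W
    proof -
      have finW: "finite W" using W(1) finU finite_subset by blast
      have cW: "card (S \<inter> W \<union> X) = card (S \<inter> W) + card X"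
        by (rule card_Un_disjoint) (use fin finW W in auto)
      have "card (W \<union> X) < card U" using W(1) finU by (rule psubset_card_mono[rotated])
      moreover have "card (W \<union> X - (S \<inter> W \<union> X)) \<le> card (U - S)"
        by (rule card_mono) (use finU W in auto)
      ultimately have "card (W \<union> X) + card (W \<union> X - (S \<inter> W \<union> X)) < card U + card (U - S)"
        by linarith
      moreover have "W \<union> X \<subseteq> V" using W(1) less.prems(1) by blast
      moreover have "S \<inter> W \<union> X \<subseteq> W \<union> X" by blast
      moreover have "real (card (S \<inter> W \<union> X)) \<le> 56 * c ^ 3"
        unfolding cW using W(4) cX less.prems(3) c by simp
      ultimately have "\<exists>f p. tree_partition (W \<union> X) E f p \<and> S \<inter> W \<union> X \<subseteq> bag (W \<union> X) f 0 \<and>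
        (\<forall>i. real (card (bag (W \<union> X) f i)) \<le> 112 * c ^ 3) \<and>
        (8 * c \<le> real (card (S \<inter> W \<union> X)) \<longrightarrow>
          real (card (bag (W \<union> X) f 0)) \<le> 2 * real (card (S \<inter> W \<union> X)) - 8 * c)"
        by (rule less.hyps)
      moreover have "8 * c \<le> real (card (S \<inter> W \<union> X))" unfolding cW using W(3) by simp
      ultimately show ?thesis unfolding cW of_nat_add by blast
    qed
    have "P \<union> X \<subset> U" "Q \<union> X \<subset> U" using U ne dis by blast+
    moreover have "real (card (S \<inter> P)) + 8 * c \<le> real (card S)"
      "real (card (S \<inter> Q)) + 8 * c \<le> real (card S)" using S cP cQ by linarith+
    ultimately obtain f1 p1 f2 p2 where
      1: "tree_partition (P \<union> X) E f1 p1" "S \<inter> P \<union> X \<subseteq> bag (P \<union> X) f1 0"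
        "\<And>i. real (card (bag (P \<union> X) f1 i)) \<le> 112 * c ^ 3"
        "real (card (bag (P \<union> X) f1 0)) \<le> 2 * (real (card (S \<inter> P)) + real (card X)) - 8 * c" and
      2: "tree_partition (Q \<union> X) E f2 p2" "S \<inter> Q \<union> X \<subseteq> bag (Q \<union> X) f2 0"
        "\<And>i. real (card (bag (Q \<union> X) f2 i)) \<le> 112 * c ^ 3"
        "real (card (bag (Q \<union> X) f2 0)) \<le> 2 * (real (card (S \<inter> Q)) + real (card X)) - 8 * c"
      using half[of P] half[of Q] cP cQ dis by (metis Int_commute)
    define f where "f = (\<lambda>x. if x \<in> P \<union> X then 2 * f1 x else 2 * f2 x - 1)"
    have sep: "\<not> E x y \<and> \<not> E y x" if "x \<in> P \<union> X - (Q \<union> X)" "y \<in> Q \<union> X - (P \<union> X)" for x y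
    proof -
      have "\<not> F x y" using that PQ by blast
      then show ?thesis using that U sym unfolding F_def by blast
    qed
    have onX: "f1 x = 0 \<and> f2 x = 0" if "x \<in> (P \<union> X) \<inter> (Q \<union> X)" for x
    proof -
      have "x \<in> X" using that dis by blast
      then show ?thesis using 1(2) 2(2) by (auto simp: bag_def)
    qed
    have UU: "U = (P \<union> X) \<union> (Q \<union> X)" using U by blast
    obtain p where T: "tree_partition U E f p"
      using tree_partition_merge[OF 1(1) 2(1) sep onX] unfolding UU f_def by blast
    have finb: "finite (bag W g i)" if "finite W" for W and g :: "'a \<Rightarrow> nat" and i
      using that by (simp add: bag_def)
    have "bag U f 0 \<subseteq> bag (P \<union> X) f1 0 \<union> bag (Q \<union> X) f2 0"
      by (auto simp: U bag_def f_def)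
    then have "card (bag U f 0) \<le> card (bag (P \<union> X) f1 0 \<union> bag (Q \<union> X) f2 0)"
      by (intro card_mono) (use fin finb in auto)
    also have "\<dots> \<le> card (bag (P \<union> X) f1 0) + card (bag (Q \<union> X) f2 0)" by (rule card_Un_le)
    finally have "real (card (bag U f 0)) \<le>
        real (card (bag (P \<union> X) f1 0)) + real (card (bag (Q \<union> X) f2 0))" by linarith
    moreover have "real (card (S \<inter> P)) + real (card (S \<inter> Q)) \<le> real (card S)"
      using S by linarith
    \<comment> \<open>The two root bounds add up to at most 2|S| + 4|X| - 16c, and 4|X| <=
      8c.\<close>
    ultimately have root: "real (card (bag U f 0)) \<le> 2 * real (card S) - 8 * c"
      using 1(4) 2(4) cX unfolding distrib_left by linarith
    have "S \<subseteq> bag U f 0"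
    proof
      fix x assume x: "x \<in> S"
      then have "x \<in> U" using less.prems(2) by blast
      then show "x \<in> bag U f 0" using x 1(2) 2(2) U by (auto simp: bag_def f_def)
    qed
    moreover have "real (card (bag U f i)) \<le> 112 * c ^ 3" for i
    proof -
      consider "i = 0" | "i > 0" "even i" | "odd i" by blast
      then show ?thesis
      proof cases
        case 1
        then show ?thesis using root less.prems(3) c by simp
      next
        case 2
        \<comment> \<open>Vertices outside \<open>P \<union> X\<close> land on 0 or on odd nodes, so
          a bag with positive even index comes from the first tree alone.\<close>
        have off: "f x = 0 \<or> odd (f x)" if "x \<notin> P \<union> X" for x
          using that by (cases "f2 x") (auto simp: f_def)
        have "x \<in> P \<union> X" if "x \<in> bag U f i" for x
          using that 2 off[of x] by (auto simp: bag_def)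
        then have "bag U f i \<subseteq> bag (P \<union> X) f1 (i div 2)"
          by (fastforce simp: bag_def f_def)
        then have "card (bag U f i) \<le> card (bag (P \<union> X) f1 (i div 2))"
          by (intro card_mono) (use fin finb in auto)
        with 1(3)[of "i div 2"] show ?thesis by linarith
      next
        case 3
        then have "bag U f i \<subseteq> bag (Q \<union> X) f2 (Suc i div 2)"
          by (auto simp: U bag_def f_def split: if_splits)
        then have "card (bag U f i) \<le> card (bag (Q \<union> X) f2 (Suc i div 2))"
          by (intro card_mono) (use fin finb in auto)
        with 2(3)[of "Suc i div 2"] show ?thesis by linarith
      qed
    qed
    ultimately show ?thesis using T root by blast
  qed
qed

section \<open>From parent functions to subgraphs of strong products\<close>

text \<open>Following parents leads every node to 0, which gives connectedness. On a cycle, both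
  neighbours of the largest node would have to be its parent, contradicting distinctness.\<close>

lemma tree_of_parents:
  assumes p: "\<And>i. p i \<le> i - (1::nat)"
  shows "tree {0..n} (\<lambda>a b. a \<le> n \<and> b \<le> n \<and> a \<noteq> b \<and> (p a = b \<or> p b = a))" (is "tree _ ?T")
proof -
  have sym: "?T a b \<Longrightarrow> ?T b a" for a b by blast
  have to_0: "i \<le> n \<Longrightarrow> (i, 0) \<in> {(a, b). ?T a b}\<^sup>*" for i
  proof (induction i rule: less_induct)
    case (less i)
    show ?case
    proof (cases "i = 0")
      case False
      then have "p i < i" using p[of i] by linarith
      moreover from this have "(i, p i) \<in> {(a, b). ?T a b}" using less.prems by auto
      ultimately show ?thesis using less by (meson converse_rtrancl_into_rtrancl less_imp_le order_trans)
    qed simp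
  qed
  have "sym ({(a, b). ?T a b}\<^sup>*)" by (rule sym_rtrancl) (auto simp: sym_def)
  with to_0 have conn: "(i, j) \<in> {(a, b). ?T a b}\<^sup>*" if "i \<le> n" "j \<le> n" for i j
    using that by (meson rtrancl_trans symD)
  have "\<not> is_cycle ?T cs" for cs
  proof
    assume C: "is_cycle ?T cs"
    let ?n = "length cs"
    have n: "?n \<ge> 3" and dist: "distinct cs" using C by (auto simp: is_cycle_def)
    \<comment> \<open>Indices modulo the length treat the closing edge like the others.\<close>
    have edge: "?T (cs ! i) (cs ! (Suc i mod ?n))" if "i < ?n" for i
    proof (cases "Suc i < ?n")
      case True
      then show ?thesis using C by (auto simp: is_cycle_def)
    next
      case False
      then have "i = ?n - 1" using that by linarith
      moreover have "cs \<noteq> []" using n by auto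
      ultimately show ?thesis using C unfolding is_cycle_def by (simp add: last_conv_nth hd_conv_nth)
    qed
    define m where "m = Max (set cs)"
    have "set cs \<noteq> {}" using n by auto
    then have "m \<in> set cs" unfolding m_def by (intro Max_in) auto
    then obtain i where i: "i < ?n" "cs ! i = m" by (auto simp: in_set_conv_nth)
    have parent: "b = p m" if "b \<in> set cs" "?T m b" for b
    proof (rule ccontr)
      assume "b \<noteq> p m"
      then have "p b = m" "b \<noteq> m" using that(2) by auto
      moreover have "b \<le> m" using that(1) by (simp add: m_def)
      ultimately show False using p[of b] by linarith
    qed
    \<comment> \<open>The cyclic predecessor of \<open>i\<close>; it differs from the cyclic
      successor because the length is at least 3.\<close>
    define j where "j = (if i = 0 then ?n - 1 else i - 1)"
    have j: "j < ?n" "Suc j mod ?n = i" using i n by (auto simp: j_def)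
    have k: "Suc i mod ?n < ?n" using n by (intro mod_less_divisor) linarith
    have "cs ! (Suc i mod ?n) = p m" using edge[OF i(1)] i k by (intro parent) auto
    moreover have "cs ! j = p m" using edge[OF j(1)] i j by (intro parent) auto
    ultimately have "Suc i mod ?n = j" using dist j(1) k by (metis nth_eq_iff_index_eq)
    then show False using i n
    proof (cases "Suc i = ?n")
      case False
      then have "Suc i mod ?n = Suc i" using i(1) by simp
      with \<open>Suc i mod ?n = j\<close> n show ?thesis by (auto simp: j_def split: if_splits)
    qed (auto simp: j_def)
  qed
  then show ?thesis using conn by (auto simp: tree_def graph_def connected_graph_def)
qed

text \<open>Number the vertices within each bag and send a vertex to its node and number. An edge
  inside a bag changes only the number; an edge between bags follows a tree edge, and the strong
  product allows any pair of numbers there.\<close>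

lemma iso_to_subgraph_of_tree_partition:
  assumes G: "graph V E" "finite V" and T: "tree_partition V E f p"
    and width: "\<And>i. card (bag V f i) \<le> t"
  shows "\<exists>(TV :: nat set) TE. tree TV TE \<and>
    iso_to_subgraph V E (strong_verts TV (complete_verts t))
      (strong_adj TV TE (complete_verts t) (complete_adj t))"
proof -
  obtain n where n: "\<And>x. x \<in> V \<Longrightarrow> f x \<le> n"
    using finite_nat_set_iff_bounded_le[of "f ` V"] G(2) by auto
  let ?TE = "\<lambda>a b. a \<le> n \<and> b \<le> n \<and> a \<noteq> b \<and> (p a = b \<or> p b = a)"
  have tree: "tree {0..n} ?TE" by (rule tree_of_parents) (use T in \<open>simp add: tree_partition_def\<close>)
  have "\<exists>h. h ` bag V f i \<subseteq> {0..<t} \<and> inj_on h (bag V f i)" for i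
    by (rule card_le_inj) (use G(2) width[of i] in \<open>simp_all add: bag_def\<close>)
  then obtain h where h: "\<And>i. inj_on (h i) (bag V f i)" "\<And>i. h i ` bag V f i \<subseteq> {0..<t}"
    by metis
  define g where "g = (\<lambda>x. (f x, h (f x) x))"
  have g: "g x \<in> {0..n} \<times> {0..<t}" if "x \<in> V" for x
    using n[OF that] h(2)[of "f x"] that by (auto simp: g_def bag_def)
  have inj: "inj_on g V"
  proof (rule inj_onI)
    fix x y assume xy: "x \<in> V" "y \<in> V" "g x = g y"
    then have "f x = f y" "h (f x) x = h (f x) y" by (auto simp: g_def)
    then show "x = y" using h(1)[of "f x"] xy by (auto simp: bag_def inj_on_def)
  qed
  \<comment> \<open>Only images of edges of \<open>E\<close> are kept, since the product may have
    further edges between the image points.\<close>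
  define F where "F = (\<lambda>a b. \<exists>x\<in>V. \<exists>y\<in>V. E x y \<and> a = g x \<and> b = g y)"
  have F: "F (g x) (g y) \<longleftrightarrow> E x y" if "x \<in> V" "y \<in> V" for x y
    using that inj unfolding F_def by (metis inj_onD)
  have graphF: "graph (g ` V) F"
  proof -
    have "\<not> F a a" for a
    proof
      assume "F a a"
      then obtain x y where "x \<in> V" "y \<in> V" "E x y" "a = g x" "a = g y"
        unfolding F_def by blast
      then show False using inj G(1) unfolding graph_def by (metis inj_onD)
    qed
    moreover have "F a b \<Longrightarrow> F b a" for a b
      using G(1) unfolding F_def graph_def by blast
    moreover have "F a b \<Longrightarrow> a \<in> g ` V \<and> b \<in> g ` V" for a b unfolding F_def by blast
    ultimately show ?thesis unfolding graph_def by blast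
  qed
  have "strong_adj {0..n} ?TE {0..<t} (complete_adj t) (g x) (g y)"
    if xy: "x \<in> V" "y \<in> V" "E x y" for x y
  proof -
    have "x \<noteq> y" using G(1) xy(3) by (auto simp: graph_def)
    then have ne: "g x \<noteq> g y" using inj xy by (metis inj_onD)
    have "f x = f y \<or> p (f x) = f y \<or> p (f y) = f x"
      using T xy by (auto simp: tree_partition_def)
    moreover have "f x \<le> n" "f y \<le> n" using n xy by auto
    ultimately have "f x = f y \<or> ?TE (f x) (f y)" by blast
    with ne g[OF xy(1)] g[OF xy(2)] show ?thesis
      by (auto simp: strong_adj_def complete_adj_def g_def)
  qed
  then have "subgraph (g ` V) F ({0..n} \<times> {0..<t})
      (strong_adj {0..n} ?TE {0..<t} (complete_adj t))"
    using graphF g unfolding subgraph_def F_def by blast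
  moreover have "graph_iso V E (g ` V) F g"
    using inj F by (simp add: graph_iso_def inj_on_imp_bij_betw)
  ultimately have "iso_to_subgraph V E ({0..n} \<times> {0..<t})
      (strong_adj {0..n} ?TE {0..<t} (complete_adj t))"
    unfolding iso_to_subgraph_def by blast
  with tree show ?thesis unfolding strong_verts_def complete_verts_def by blast
qed

theorem theorem13:
  fixes c :: real and V :: "'a set" and E :: "'a \<Rightarrow> 'a \<Rightarrow> bool"
  assumes "c \<ge> 1"
    and "graph V E" and "finite V"
    and "\<forall>r::nat. r > 0 \<longrightarrow> real (growth V E r) \<le> c * real r"
  shows "\<exists>(TV :: nat set) TE. tree TV TE \<and>
           iso_to_subgraph V E
             (strong_verts TV (complete_verts (nat \<lfloor>882 * c ^ 3\<rfloor>)))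
             (strong_adj TV TE (complete_verts (nat \<lfloor>882 * c ^ 3\<rfloor>)) (complete_adj (nat \<lfloor>882 * c ^ 3\<rfloor>)))"
proof -
  have growth: "real (card (nball E w r)) \<le> c * real r" if "w \<in> V" "r > 0" for w r
    using card_nball_le_growth[OF assms(2,3) that(1), of r] assms(4) that(2)
    by (meson of_nat_mono order_trans)
  \<comment> \<open>The recursion starts from \<open>U = V\<close> with nothing prescribed. Its
    width 112c^3 is below 882c^3.\<close>
  have c3: "0 \<le> c ^ 3" using assms(1) by simp
  then obtain f p where T: "tree_partition V E f p"
    and width: "\<And>i. real (card (bag V f i)) \<le> 112 * c ^ 3"
    using tree_partition_exists[OF assms(1-3) growth, of V "{}"] by auto
  have "card (bag V f i) \<le> nat \<lfloor>882 * c ^ 3\<rfloor>" for i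
    using width[of i] c3 by (simp add: le_nat_floor)
  then show ?thesis by (rule iso_to_subgraph_of_tree_partition[OF assms(2,3) T])
qed

end
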